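(* (Honsberger identity.) For all integers $n, m \ge 0$, \[ Q^P_n\,Q^P_m + Q^P_{n+1}\,Q^P_{m+1} = Q^P_{n+m+1} - P_{n+m+3} + i\,P_{n+m+2} + \varepsilon\,(P_{n+m+3} - 2P_{n+m+5}) + 3\,i\varepsilon\,P_{n+m+4}. \]
   Context: Dual-complex numbers are expressions $x_1 + i\,x_2 + \varepsilon\,y_1 + i\varepsilon\,y_2$ with real coefficients, forming a commutative associative real algebra with basis $\{1,i,\varepsilon,i\varepsilon\}$, where $i^2=-1$, $\varepsilon\ne 0$, $\varepsilon^2=0$, $i\varepsilon=\varepsilon i$, $(i\varepsilon)^2=0$. Pell numbers: $P_0=0$, $P_1=1$, $P_n=2P_{n-1}+P_{n-2}$. The dual-complex Pell quaternion is $Q^P_n = P_n + i\,P_{n+1} + \varepsilon\,P_{n+2} + i\varepsilon\,P_{n+3}$, with products taken in the dual-complex algebra. *)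

theory Defs
  imports Complex_Main
begin

text \<open>\<open>DC x\<^sub>1 x\<^sub>2 y\<^sub>1 y\<^sub>2\<close> stands for $x_1 + i\,x_2 + \varepsilon\,y_1 + i\varepsilon\,y_2$.\<close>

datatype dual_complex =
  DC (dc_re: real) (dc_im: real) (dc_eps: real) (dc_ieps: real)

lemma dual_complex_eq_iff:
  "z = w \<longleftrightarrow> dc_re z = dc_re w \<and> dc_im z = dc_im w \<and> dc_eps z = dc_eps w \<and> dc_ieps z = dc_ieps w"
  by (auto intro: dual_complex.expand)

instantiation dual_complex :: "{comm_ring_1, real_algebra_1}"
begin

definition "0 = DC 0 0 0 0"

definition "1 = DC 1 0 0 0"

definition "z + w =
  DC (dc_re z + dc_re w) (dc_im z + dc_im w) (dc_eps z + dc_eps w) (dc_ieps z + dc_ieps w)"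

definition "- z = DC (- dc_re z) (- dc_im z) (- dc_eps z) (- dc_ieps z)"

definition "z - w =
  DC (dc_re z - dc_re w) (dc_im z - dc_im w) (dc_eps z - dc_eps w) (dc_ieps z - dc_ieps w)"

definition "r *\<^sub>R z = DC (r * dc_re z) (r * dc_im z) (r * dc_eps z) (r * dc_ieps z)"

text \<open>The product is the bilinear extension of $i^2 = -1$, $\varepsilon^2 = 0$,
  $i\varepsilon = \varepsilon i$; see \<open>dc_i_squared\<close>, \<open>dc_epsilon_squared\<close> and
  \<open>DC_expand\<close> below.\<close>

definition "z * w =
  DC (dc_re z * dc_re w - dc_im z * dc_im w)
     (dc_re z * dc_im w + dc_im z * dc_re w)
     (dc_re z * dc_eps w + dc_eps z * dc_re w - dc_im z * dc_ieps w - dc_ieps z * dc_im w)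
     (dc_re z * dc_ieps w + dc_ieps z * dc_re w + dc_im z * dc_eps w + dc_eps z * dc_im w)"

instance
  by standard
    (simp_all add: dual_complex_eq_iff zero_dual_complex_def one_dual_complex_def
      plus_dual_complex_def uminus_dual_complex_def minus_dual_complex_def
      scaleR_dual_complex_def times_dual_complex_def algebra_simps)

end

definition dc_i :: dual_complex where "dc_i = DC 0 1 0 0"

definition dc_epsilon :: dual_complex where "dc_epsilon = DC 0 0 1 0"

lemma dc_i_squared: "dc_i * dc_i = - 1"
  by (simp add: dc_i_def times_dual_complex_def uminus_dual_complex_def one_dual_complex_def)

lemma dc_epsilon_nonzero: "dc_epsilon \<noteq> 0"
  by (simp add: dc_epsilon_def zero_dual_complex_def)

lemma dc_epsilon_squared: "dc_epsilon * dc_epsilon = 0"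
  by (simp add: dc_epsilon_def times_dual_complex_def zero_dual_complex_def)

lemma DC_expand:
  "DC x1 x2 y1 y2 =
    of_real x1 + dc_i * of_real x2 + dc_epsilon * of_real y1 + dc_i * dc_epsilon * of_real y2"
  by (simp add: dc_i_def dc_epsilon_def of_real_def times_dual_complex_def
      plus_dual_complex_def scaleR_dual_complex_def one_dual_complex_def)

fun pell :: "nat \<Rightarrow> nat" where
  "pell 0 = 0"
| "pell (Suc 0) = 1"
| "pell (Suc (Suc n)) = 2 * pell (Suc n) + pell n"

definition pell_quaternion :: "nat \<Rightarrow> dual_complex" where
  "pell_quaternion n =
    of_nat (pell n) + dc_i * of_nat (pell (n + 1)) + dc_epsilon * of_nat (pell (n + 2))
      + dc_i * dc_epsilon * of_nat (pell (n + 3))"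

end

theory Submission
  imports Defs
begin

text \<open>For fixed \<open>b\<close>, both sides of \<open>pell_honsberger\<close> satisfy the
  Pell recurrence in \<open>a\<close> and agree at \<open>a = 0, 1\<close>. With S = n + m, the
  components of the left side of the theorem collapse to P_(S+1) - P_(S+3), 2 P_(S+2), 2 P_(S+3) - 2
  P_(S+5) and 4 P_(S+4); the correction terms are the difference from Q_(S+1).\<close>

text \<open>Multiplying out in the basis $1, i, \varepsilon, i\varepsilon$, each component is a signed
  sum of terms $P_a P_b + P_{a+1} P_{b+1}$, each of which is $P_{a+b+1}$.\<close>

lemma pell_honsberger: "pell a * pell b + pell (a + 1) * pell (b + 1) = pell (a + b + 1)"
  by (induction a rule: pell.induct) (simp_all add: algebra_simps)

lemma of_nat_dual_complex: "of_nat k = DC (real k) 0 0 0"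
  by (induction k)
    (simp_all add: zero_dual_complex_def one_dual_complex_def plus_dual_complex_def)

lemma numeral_dual_complex: "numeral w = DC (numeral w) 0 0 0"
  using of_nat_dual_complex[of "numeral w"] by simp

lemma pell_quaternion_eq_DC:
  "pell_quaternion n = DC (pell n) (pell (n + 1)) (pell (n + 2)) (pell (n + 3))"
  by (simp add: pell_quaternion_def DC_expand)

theorem theorem3p2:
  fixes n m :: nat
  shows "pell_quaternion n * pell_quaternion m + pell_quaternion (n + 1) * pell_quaternion (m + 1) =
    pell_quaternion (n + m + 1) - of_nat (pell (n + m + 3))
      + dc_i * of_nat (pell (n + m + 2))
      + dc_epsilon * (of_nat (pell (n + m + 3)) - 2 * of_nat (pell (n + m + 5)))
      + 3 * dc_i * dc_epsilon * of_nat (pell (n + m + 4))"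
proof -
  have H: "real (pell (n + j)) * real (pell (m + k)) + real (pell (n + j + 1)) * real (pell (m + k + 1))
      = real (pell (n + m + j + k + 1))" for j k
    using pell_honsberger[of "n + j" "m + k"]
    by (metis (no_types, lifting) add.assoc add.commute add.left_commute of_nat_add of_nat_mult)
  note dc_simps = dual_complex_eq_iff of_nat_dual_complex numeral_dual_complex dc_i_def
    dc_epsilon_def times_dual_complex_def plus_dual_complex_def minus_dual_complex_def
    pell_quaternion_eq_DC
  show ?thesis
    \<comment> \<open>Offsets (0,0), (1,1) give the real part; (0,1), (1,0) the i part; (0,2),
      (2,0), (1,3), (3,1) the eps part; the rest the i eps part. Those with both offsets odd carry a
      minus sign, from i^2 = -1.\<close>
    using H[of 0 0] H[of 1 1] H[of 0 1] H[of 1 0] H[of 0 2] H[of 2 0] H[of 1 3] H[of 3 1]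
      H[of 0 3] H[of 3 0] H[of 1 2] H[of 2 1]
    \<comment> \<open>Disabling the recurrence and the rewriting to \<open>Suc\<close> keeps Pell
      values opaque, in the form used by \<open>H\<close>.\<close>
    by (simp add: dc_simps add.assoc
        del: pell.simps add_2_eq_Suc' One_nat_def)
qed

end
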